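(* Let $\theta>0$ and let $m\ge 1$ be a fixed integer. For the problem of selecting the $m$th last success in a sequence of $n$ independent Bernoulli trials with success probabilities $p_k=\theta/(\theta+k-1)$, $k=1,\dots,n$, the threshold policy which stops at the first success, if any, on or after the index $$k_{\mathrm{poi}}(n):=\min\Big\{k\in\{1,\dots,n\}:\ \frac kn\ge \exp\Big(-\frac m\theta\Big)\Big\}\vee 1$$ is asymptotically optimal as $n\to\infty$. Moreover, the asymptotic (i.e. limiting as $n\to\infty$) winning probability is $$\frac{m^m}{m!}\exp(-m).$$
   Context: Selection problem: $X_1,\dots,X_n$ are independent Bernoulli trials with $p_k=P(X_k=1)$. Let $\mathcal F_k=\sigma(X_1,\dots,X_k)$. Let $\mathcal T$ be the class of stopping rules $\tau$ with $\{\tau=k\}\in\mathcal F_k$ for each $k$ and $X_\tau=1$ whenever the rule stops; rules may also never stop. A rule wins if it stops and $\sum_{j=\tau}^n X_j=m$, i.e. if it stops exactly on the $m$th last success. The optimal winning probability is $s_m^*(n)=\sup_{\tau\in\mathcal T}P\big(\sum_{j=\tau}^nX_j=m\big)$, where never stopping counts as not winning. The policy that stops on the first success on or after index $k$ wins with probability $P(X_k+\cdots+X_n=m)$. A sequence of policies, one for each $n$, is asymptotically optimal if the difference between $s_m^*(n)$ and its winning probability tends to $0$ as $n\to\infty$. Notation: $a\vee b=\max(a,b)$. *)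

theory Defs
  imports "HOL-Probability.Probability"
begin

text \<open>A trial is a Boolean random variable; \<^term>\<open>True\<close> is a success, i.e. the value 1.\<close>

locale bernoulli_trials = prob_space M for M :: "'a measure" +
  fixes X :: "nat \<Rightarrow> 'a \<Rightarrow> bool" and n :: nat and p :: "nat \<Rightarrow> real"
  assumes indep: "indep_vars (\<lambda>_. count_space UNIV) X {1..n}"
    and success_prob: "\<And>k. k \<in> {1..n} \<Longrightarrow> prob {\<omega> \<in> space M. X k \<omega>} = p k"

definition trial_filtration :: "'a measure \<Rightarrow> (nat \<Rightarrow> 'a \<Rightarrow> bool) \<Rightarrow> nat \<Rightarrow> 'a measure" where
  "trial_filtration M X k = sigma (space M) {X i -` A \<inter> space M | i A. i \<in> {1..k}}"

text \<open>A rule maps an outcome to \<^term>\<open>Some k\<close> if it stops at trial \<open>k\<close> and to \<^term>\<open>None\<close> if it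
  never stops.\<close>

definition stopping_rules ::
  "'a measure \<Rightarrow> (nat \<Rightarrow> 'a \<Rightarrow> bool) \<Rightarrow> nat \<Rightarrow> ('a \<Rightarrow> nat option) set" where
  "stopping_rules M X n =
     {\<tau>. (\<forall>k\<in>{1..n}. {\<omega> \<in> space M. \<tau> \<omega> = Some k} \<in> sets (trial_filtration M X k)) \<and>
         (\<forall>\<omega>\<in>space M. \<forall>k. \<tau> \<omega> = Some k \<longrightarrow> k \<in> {1..n} \<and> X k \<omega>)}"

definition win_prob ::
  "'a measure \<Rightarrow> (nat \<Rightarrow> 'a \<Rightarrow> bool) \<Rightarrow> nat \<Rightarrow> nat \<Rightarrow> ('a \<Rightarrow> nat option) \<Rightarrow> real" where
  "win_prob M X n m \<tau> =
     measure M {\<omega> \<in> space M. \<exists>k. \<tau> \<omega> = Some k \<and> (\<Sum>j=k..n. of_bool (X j \<omega>)) = m}"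

definition optimal_win_prob :: "'a measure \<Rightarrow> (nat \<Rightarrow> 'a \<Rightarrow> bool) \<Rightarrow> nat \<Rightarrow> nat \<Rightarrow> real" where
  "optimal_win_prob M X n m = (SUP \<tau>\<in>stopping_rules M X n. win_prob M X n m \<tau>)"

definition threshold_rule :: "(nat \<Rightarrow> 'a \<Rightarrow> bool) \<Rightarrow> nat \<Rightarrow> nat \<Rightarrow> 'a \<Rightarrow> nat option" where
  "threshold_rule X n k \<omega> =
     (if \<exists>j\<in>{k..n}. X j \<omega> then Some (LEAST j. j \<in> {k..n} \<and> X j \<omega>) else None)"

text \<open>The problem with \<open>n\<close> trials lives on its own probability space \<open>M n\<close>, with trials \<open>X n\<close>.\<close>

definition asymptotically_optimal ::
  "(nat \<Rightarrow> 'a measure) \<Rightarrow> (nat \<Rightarrow> nat \<Rightarrow> 'a \<Rightarrow> bool) \<Rightarrow> nat \<Rightarrow> (nat \<Rightarrow> 'a \<Rightarrow> nat option) \<Rightarrow> bool" where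
  "asymptotically_optimal M X m \<tau> \<longleftrightarrow>
     (\<forall>n\<ge>1. \<tau> n \<in> stopping_rules (M n) (X n) n) \<and>
     (\<lambda>n. optimal_win_prob (M n) (X n) n m - win_prob (M n) (X n) n m (\<tau> n)) \<longlonglongrightarrow> 0"

text \<open>For \<open>n \<ge> 1\<close> the set below contains \<open>n\<close>, so its minimum is meaningful.\<close>

definition k_poi :: "nat \<Rightarrow> real \<Rightarrow> nat \<Rightarrow> nat" where
  "k_poi m \<theta> n = max (Min {k \<in> {1..n}. real k / real n \<ge> exp (- (real m / \<theta>))}) 1"

end

theory Submission
  imports Defs "HOL-Real_Asymp.Real_Asymp"
begin

text \<open>
  Let \<open>N\<^sub>k\<close> be the number of successes among the trials \<open>k, \<dots>, n\<close>. Convolution with a Bernoulli law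
  preserves unimodality and moves the mode by at most one to the right, so the sign of
  \<open>P(N\<^sub>k = m) - P(N\<^sub>k = m - 1)\<close> changes at most once in \<open>k\<close>. Backward induction then shows that no rule
  beats \<open>P(N\<^sub>s = m)\<close> for a suitable threshold \<open>s\<close>. By a Taylor estimate the law of \<open>N\<^sub>k\<close> is within
  \<open>2 (p\<^sub>k\<^sup>2 + \<dots> + p\<^sub>n\<^sup>2)\<close> of the Poisson law with the same mean, and the mean is about \<open>\<theta> ln (n / k)\<close>,
  which tends to \<open>m\<close> for \<open>k = k_poi m \<theta> n\<close>. This value is the limit because \<open>t = m\<close> maximises
  \<open>t^m exp (- t) / m!\<close>.
\<close>

section \<open>Poisson binomial laws\<close>

text \<open>The law of \<open>N + 1\<close> if \<open>a\<close> is the law of \<open>N\<close>. The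
  value 0 stands for the mass at -1, so truncated subtraction never enters.\<close>

definition shift_right :: "(nat \<Rightarrow> real) \<Rightarrow> nat \<Rightarrow> real" where
  "shift_right a m = (case m of 0 \<Rightarrow> 0 | Suc j \<Rightarrow> a j)"

lemma shift_right_simps [simp]: "shift_right a 0 = 0" "shift_right a (Suc j) = a j"
  by (simp_all add: shift_right_def)

text \<open>The law of a sum of independent Bernoulli trials, by conditioning on the head. Lists fit
  because passing from trials \<open>Suc k\<close>, ..., \<open>n\<close> to \<open>k\<close>, ...,
  \<open>n\<close> is a \<open>Cons\<close>.\<close>

primrec pois_binomial :: "real list \<Rightarrow> nat \<Rightarrow> real" where
  "pois_binomial [] m = of_bool (m = 0)"
| "pois_binomial (q # qs) m = q * shift_right (pois_binomial qs) m + (1 - q) * pois_binomial qs m"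

lemma pois_binomial_nonneg:
  assumes "set qs \<subseteq> {0..1}"
  shows "0 \<le> pois_binomial qs m"
  using assms by (induction qs arbitrary: m) (auto simp: shift_right_def split: nat.split)

text \<open>Shifting a law removes the last term from its cumulative sum, so all but one correction
  term cancel.\<close>

lemma pois_binomial_cdf_Cons:
  "(\<Sum>j\<le>m. pois_binomial (q # qs) j) = (\<Sum>j\<le>m. pois_binomial qs j) - q * pois_binomial qs m"
  by (induction m) (simp_all add: algebra_simps)

text \<open>Further trials can only raise the number of successes, so they lower its distribution
  function.\<close>

lemma pois_binomial_cdf_append_le:
  assumes "set (ps @ qs) \<subseteq> {0..1}"
  shows "(\<Sum>j\<le>m. pois_binomial (ps @ qs) j) \<le> (\<Sum>j\<le>m. pois_binomial qs j)"
  using assms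
proof (induction ps)
  case (Cons q ps)
  then have "(\<Sum>j\<le>m. pois_binomial (ps @ qs) j) \<le> (\<Sum>j\<le>m. pois_binomial qs j)"
    and "0 \<le> q * pois_binomial (ps @ qs) m"
    using pois_binomial_nonneg[of "ps @ qs" m] by auto
  then show ?case
    unfolding append_Cons pois_binomial_cdf_Cons by linarith
qed simp

section \<open>Unimodality and the movement of the mode\<close>

definition unimodal_at :: "(nat \<Rightarrow> real) \<Rightarrow> nat \<Rightarrow> bool" where
  "unimodal_at a l \<longleftrightarrow> (\<forall>j\<le>l. shift_right a j \<le> a j) \<and> (\<forall>j>l. a j \<le> shift_right a j)"

text \<open>The increments of the new law mix the old increments with their shifts. Both have the
  same sign everywhere except at \<open>Suc l\<close>, and the sign of the mixture there decides
  between the two modes.\<close>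

lemma unimodal_at_Cons:
  assumes "unimodal_at (pois_binomial qs) l" "0 \<le> q" "q \<le> 1" "set qs \<subseteq> {0..1}"
  shows "unimodal_at (pois_binomial (q # qs)) l \<or> unimodal_at (pois_binomial (q # qs)) (Suc l)"
proof -
  let ?a = "pois_binomial qs" and ?b = "pois_binomial (q # qs)"
  have diff: "?b j - shift_right ?b j = q * (shift_right ?a j - shift_right (shift_right ?a) j) + (1 - q) * (?a j - shift_right ?a j)" for j
    by (cases j) (simp_all add: algebra_simps)
  have up: "shift_right ?b j \<le> ?b j" if "j \<le> l" for j
  proof -
    have "shift_right (shift_right ?a) j \<le> shift_right ?a j"
      using that assms(1) pois_binomial_nonneg[OF assms(4)] by (cases j) (auto simp: unimodal_at_def)
    moreover have "shift_right ?a j \<le> ?a j" using that assms(1) by (auto simp: unimodal_at_def)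
    ultimately have "0 \<le> ?b j - shift_right ?b j" unfolding diff using assms by simp
    then show ?thesis by simp
  qed
  have down: "?b j \<le> shift_right ?b j" if "j > Suc l" for j
  proof -
    have "shift_right ?a j \<le> shift_right (shift_right ?a) j"
      using that assms(1) by (cases j) (auto simp: unimodal_at_def)
    moreover have "?a j \<le> shift_right ?a j" using that assms(1) by (auto simp: unimodal_at_def)
    ultimately have "0 \<le> q * (shift_right (shift_right ?a) j - shift_right ?a j) + (1 - q) * (shift_right ?a j - ?a j)"
      using assms by simp
    then have "?b j - shift_right ?b j \<le> 0" unfolding diff by (simp add: algebra_simps)
    then show ?thesis by simp
  qed
  show ?thesis
  proof (cases "shift_right ?b (Suc l) \<le> ?b (Suc l)")
    case True
    then have "unimodal_at ?b (Suc l)"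
      using up down unfolding unimodal_at_def by (metis le_Suc_eq)
    then show ?thesis ..
  next
    case False
    then have "?b j \<le> shift_right ?b j" if "j > l" for j
      using down[of j] that by (cases "j = Suc l") auto
    then have "unimodal_at ?b l"
      using up unfolding unimodal_at_def by blast
    then show ?thesis ..
  qed
qed

lemma unimodal_at_pois_binomial:
  assumes "set qs \<subseteq> {0..1}"
  shows "\<exists>l. unimodal_at (pois_binomial qs) l"
  using assms
proof (induction qs)
  case Nil
  have "unimodal_at (pois_binomial []) 0" by (auto simp: unimodal_at_def shift_right_def split: nat.split)
  then show ?case ..
next
  case (Cons q qs)
  then obtain l where "unimodal_at (pois_binomial qs) l" by auto
  then show ?case using unimodal_at_Cons[of qs l q] Cons.prems by (auto simp del: pois_binomial.simps)
qed

section \<open>Poisson masses as functions of the mean, and Poisson approximation\<close>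

definition poisson_mass :: "real \<Rightarrow> nat \<Rightarrow> real" where
  "poisson_mass t m = t ^ m / fact m * exp (- t)"

lemma poisson_mass_nonneg: "0 \<le> t \<Longrightarrow> 0 \<le> poisson_mass t m"
  by (simp add: poisson_mass_def)

lemma poisson_mass_le_1: "0 \<le> t \<Longrightarrow> poisson_mass t m \<le> 1"
  using pmf_le_1[of "poisson_pmf t" m]
  by (cases "t = 0") (auto simp: poisson_mass_def power_0_left)

text \<open>The inequality \<open>x <= exp (x - 1)\<close> at \<open>x = t / m\<close>, raised to
  the power \<open>m\<close>.\<close>

lemma poisson_mass_le_mode:
  assumes "0 \<le> t" "m \<ge> 1"
  shows "poisson_mass t m \<le> poisson_mass (real m) m"
proof -
  have "t / m \<le> exp (t / m - 1)" using exp_ge_add_one_self[of "t / m - 1"] by simp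
  then have "(t / m) ^ m \<le> exp (t / m - 1) ^ m" using assms by (intro power_mono) auto
  also have "\<dots> = exp (t - m)" using assms by (simp flip: exp_of_nat_mult add: right_diff_distrib)
  finally have "t ^ m \<le> m ^ m * exp (t - m)"
    using assms by (simp add: power_divide field_simps)
  then have "t ^ m * exp (- t) \<le> m ^ m * exp (- m)"
    by (simp add: exp_diff exp_minus field_simps)
  then show ?thesis by (simp add: poisson_mass_def divide_right_mono)
qed

text \<open>Differentiation in the mean acts as shift minus identity, so higher derivatives come
  from further shifts.\<close>

lemma has_real_derivative_poisson_mass:
  "((\<lambda>t. poisson_mass t m) has_real_derivative shift_right (poisson_mass t) m - poisson_mass t m) (at t)"
proof (cases m)
  case 0
  then show ?thesis unfolding poisson_mass_def by (auto intro!: derivative_eq_intros)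
next
  case (Suc j)
  have "((\<lambda>t. poisson_mass t (Suc j)) has_real_derivative
     (real (Suc j) * t ^ j / fact (Suc j) * exp (- t) - t ^ Suc j / fact (Suc j) * exp (- t))) (at t)"
    unfolding poisson_mass_def by (rule derivative_eq_intros refl | simp)+
  moreover have "real (Suc j) * t ^ j / fact (Suc j) = t ^ j / fact j"
    by (simp add: divide_simps)
  ultimately show ?thesis unfolding Suc shift_right_simps by (simp only: poisson_mass_def)
qed

text \<open>Adding a Bernoulli trial to a Poisson variable gives the first-order Taylor polynomial
  in \<open>q\<close> of the mass at mean \<open>t + q\<close>. Two uses of the mean value theorem
  turn the remainder into \<open>q * (x - t) * E y\<close> with \<open>x - t < q\<close>.\<close>

lemma poisson_mass_bernoulli_step:
  assumes "0 \<le> t" "0 \<le> q"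
  shows "\<bar>poisson_mass (t + q) m - (q * shift_right (poisson_mass t) m + (1 - q) * poisson_mass t m)\<bar> \<le> 2 * q\<^sup>2"
proof (cases "q = 0")
  case False
  define D where "D s = shift_right (poisson_mass s) m - poisson_mass s m" for s
  define E where "E s = (shift_right (shift_right (poisson_mass s)) m - shift_right (poisson_mass s) m) - D s" for s
  have D: "((\<lambda>t. poisson_mass t m) has_real_derivative D s) (at s)" for s
    unfolding D_def by (rule has_real_derivative_poisson_mass)
  have shift_D: "((\<lambda>t. shift_right (poisson_mass t) m) has_real_derivative
      shift_right (shift_right (poisson_mass s)) m - shift_right (poisson_mass s) m) (at s)" for s
    by (cases m) (auto simp: has_real_derivative_poisson_mass)
  have E: "(D has_real_derivative E s) (at s)" for s
    using DERIV_diff[OF shift_D[of s] has_real_derivative_poisson_mass[of m s]]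
    unfolding D_def[abs_def] E_def .
  obtain x where x: "t < x" "x < t + q" "poisson_mass (t + q) m - poisson_mass t m = q * D x"
    using MVT2[of t "t + q" "\<lambda>t. poisson_mass t m" D] D False assms by auto
  obtain y where y: "t < y" "y < x" "D x - D t = (x - t) * E y"
    using MVT2[of t x D E] E x by auto
  have bounds: "0 \<le> poisson_mass y j \<and> poisson_mass y j \<le> 1" for j
    using y assms poisson_mass_nonneg poisson_mass_le_1 by auto
  have shift_bounds: "0 \<le> shift_right (poisson_mass y) j \<and> shift_right (poisson_mass y) j \<le> 1" for j
    using bounds by (cases j) auto
  have "0 \<le> shift_right (shift_right (poisson_mass y)) m \<and> shift_right (shift_right (poisson_mass y)) m \<le> 1"
    using shift_bounds by (cases m) auto
  \<comment> \<open>\<open>E y\<close> is a second difference \<open>u - 2 * v + w\<close> of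
    numbers in [0, 1]; this is the source of the constant 2.\<close>
  with bounds[of m] shift_bounds[of m] have "\<bar>E y\<bar> \<le> 2" unfolding E_def D_def by linarith
  then have "\<bar>x - t\<bar> * \<bar>E y\<bar> \<le> q * 2" using x by (intro mult_mono) auto
  then have "q * \<bar>D x - D t\<bar> \<le> q * (q * 2)"
    unfolding y(3) abs_mult using assms by (intro mult_left_mono) auto
  moreover have "poisson_mass (t + q) m - (q * shift_right (poisson_mass t) m + (1 - q) * poisson_mass t m)
      = q * (D x - D t)"
    using x(3) by (simp add: D_def algebra_simps)
  ultimately show ?thesis using assms by (simp add: abs_mult power2_eq_square mult_ac)
qed simp

text \<open>A pointwise form of Le Cam's bound. The error inherited from the tail enters as a convex
  combination with weights \<open>q\<close> and \<open>1 - q\<close>, so it does not grow; each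
  trial adds its own \<open>2 * q\<^sup>2\<close>.\<close>

lemma pois_binomial_poisson_mass:
  assumes "set qs \<subseteq> {0..1}"
  shows "\<bar>pois_binomial qs m - poisson_mass (sum_list qs) m\<bar> \<le> 2 * (\<Sum>q\<leftarrow>qs. q\<^sup>2)"
  using assms
proof (induction qs arbitrary: m)
  case Nil
  show ?case by (simp add: poisson_mass_def power_0_left)
next
  case (Cons q qs)
  let ?a = "pois_binomial qs" and ?b = "poisson_mass (sum_list qs)" and ?e = "2 * (\<Sum>q\<leftarrow>qs. q\<^sup>2)"
  have q: "0 \<le> q" "q \<le> 1" and e: "\<bar>?a j - ?b j\<bar> \<le> ?e" for j using Cons by auto
  have "0 \<le> ?e" using e[of 0] by linarith
  then have "\<bar>shift_right ?a m - shift_right ?b m\<bar> \<le> ?e" using e by (cases m) auto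
  then have "\<bar>q * (shift_right ?a m - shift_right ?b m) + (1 - q) * (?a m - ?b m)\<bar> \<le> q * ?e + (1 - q) * ?e"
    using q e[of m] by (intro order_trans[OF abs_triangle_ineq] add_mono) (simp_all add: abs_mult mult_left_mono)
  moreover have "\<bar>poisson_mass (sum_list qs + q) m - (q * shift_right ?b m + (1 - q) * ?b m)\<bar> \<le> 2 * q\<^sup>2"
    using poisson_mass_bernoulli_step[of "sum_list qs" q m] q Cons.prems sum_list_nonneg[of qs] by force
  ultimately show ?case by (simp add: algebra_simps abs_le_iff)
qed

text \<open>For \<open>m >= 1\<close>, a stop on a success at \<open>k\<close> wins if
  \<open>m - 1\<close> successes follow; passing on, with threshold \<open>Suc k\<close>, wins if
  \<open>m\<close> follow. The lemma says that this comparison switches at most once, at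
  \<open>s\<close>.\<close>

lemma pois_binomial_threshold:
  fixes p :: "nat \<Rightarrow> real" and n m :: nat
  assumes p: "p ` {1..n} \<subseteq> {0..1}"
  defines "a k \<equiv> pois_binomial (map p [k..<Suc n])"
  obtains s where "1 \<le> s" "s \<le> Suc n"
    and "\<And>k. 1 \<le> k \<Longrightarrow> k < s \<Longrightarrow> shift_right (a (Suc k)) m \<le> a (Suc k) m"
    and "\<And>k. s \<le> k \<Longrightarrow> k \<le> n \<Longrightarrow> a (Suc k) m \<le> shift_right (a (Suc k)) m"
proof -
  \<comment> \<open>Modes need not be unique: \<open>high k\<close> asks for some mode at or beyond
    \<open>m\<close>, so its negation puts every mode strictly before \<open>m\<close>. A prepended
    trial keeps or advances the mode, hence \<open>high\<close> passes from \<open>Suc k\<close> to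
    \<open>k\<close>.\<close>
  define high where "high k \<longleftrightarrow> (\<exists>l\<ge>m. unimodal_at (a k) l)" for k
  have p_set: "set (map p [k..<Suc n]) \<subseteq> {0..1}" if "1 \<le> k" for k
    using p that by auto
  have low: "a k m \<le> shift_right (a k) m" if "\<not> high k" "1 \<le> k" for k
    using unimodal_at_pois_binomial[OF p_set[OF that(2)]] that(1)
    unfolding high_def a_def by (metis not_le unimodal_at_def)
  have high_step: "high k" if high: "high (Suc k)" and k: "1 \<le> k" "k \<le> n" for k
  proof -
    obtain l where l: "l \<ge> m" "unimodal_at (a (Suc k)) l" using high unfolding high_def by auto
    have "map p [k..<Suc n] = p k # map p [Suc k..<Suc n]"
      using k by (simp add: upt_conv_Cons del: upt_Suc)
    moreover have "0 \<le> p k" "p k \<le> 1" using p k by (auto simp: image_subset_iff)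
    ultimately have "unimodal_at (a k) l \<or> unimodal_at (a k) (Suc l)"
      using unimodal_at_Cons[OF l(2)[unfolded a_def] _ _ p_set, of "p k"] unfolding a_def by auto
    with l show ?thesis unfolding high_def by (meson le_SucI)
  qed
  have high_mono: "high j" if "j \<le> k" "high k" "1 \<le> j" "k \<le> Suc n" for j k
    using that by (induction rule: inc_induct) (auto intro: high_step)
  \<comment> \<open>The decision at \<open>k\<close> concerns the trials after it, hence
    \<open>Suc k\<close>. The alternative \<open>k = Suc n\<close> makes the minimum exist and
    stands for never stopping.\<close>
  define s where "s = (LEAST k. 1 \<le> k \<and> (k = Suc n \<or> \<not> high (Suc k)))"
  have s: "1 \<le> s" "s = Suc n \<or> \<not> high (Suc s)"
    using LeastI[of "\<lambda>k. 1 \<le> k \<and> (k = Suc n \<or> \<not> high (Suc k))" "Suc n"] unfolding s_def by auto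
  have s_le: "s \<le> Suc n" unfolding s_def by (rule Least_le) simp
  show thesis
  proof
    fix k assume k: "1 \<le> k" "k < s"
    then have "high (Suc k)" using not_less_Least[of k] unfolding s_def by blast
    then show "shift_right (a (Suc k)) m \<le> a (Suc k) m" unfolding high_def unimodal_at_def by auto
  next
    fix k assume k: "s \<le> k" "k \<le> n"
    then have "\<not> high (Suc k)" using s s_le high_mono[of "Suc s" "Suc k"] by auto
    then show "a (Suc k) m \<le> shift_right (a (Suc k)) m" by (rule low) simp
  qed (use s s_le in auto)
qed

section \<open>Winning probabilities of stopping rules\<close>

text \<open>Covers both the past and the future of a trial. For \<open>l < k\<close> it is the
  trivial sigma-algebra, which is what is known before the first trial.\<close>

definition trial_block :: "'a measure \<Rightarrow> (nat \<Rightarrow> 'a \<Rightarrow> bool) \<Rightarrow> nat \<Rightarrow> nat \<Rightarrow> 'a measure" where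
  "trial_block M X k l = sigma (space M) {X i -` A \<inter> space M | i A. i \<in> {k..l}}"

lemma trial_filtration_eq_block: "trial_filtration M X k = trial_block M X 1 k"
  by (simp add: trial_filtration_def trial_block_def)

lemma space_trial_block [simp]: "space (trial_block M X k l) = space M"
  by (auto simp: trial_block_def intro!: space_measure_of)

lemma sets_trial_block:
  "sets (trial_block M X k l) = sigma_sets (space M) {X i -` A \<inter> space M | i A. i \<in> {k..l}}"
  by (auto simp: trial_block_def intro!: sets_measure_of)

lemma sets_trial_block_mono:
  "k' \<le> k \<Longrightarrow> l \<le> l' \<Longrightarrow> sets (trial_block M X k l) \<subseteq> sets (trial_block M X k' l')"
  unfolding sets_trial_block by (intro sigma_sets_mono') fastforce

lemma measurable_trial_block:
  "i \<in> {k..l} \<Longrightarrow> X i \<in> measurable (trial_block M X k l) (count_space UNIV)"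
  by (rule measurableI) (auto simp: sets_trial_block intro!: sigma_sets.Basic)

lemma successes_trial_block:
  "{\<omega> \<in> space M. (\<Sum>j=k..l. of_bool (X j \<omega>)) = (m::nat)} \<in> sets (trial_block M X k l)"
proof -
  have "(\<lambda>\<omega>. \<Sum>j=k..l. of_bool (X j \<omega>) :: nat) \<in> measurable (trial_block M X k l) (count_space UNIV)"
    using measurable_trial_block[of _ k l X M] by measurable
  then have "(\<lambda>\<omega>. \<Sum>j=k..l. of_bool (X j \<omega>) :: nat) -` {m} \<inter> space M \<in> sets (trial_block M X k l)"
    using measurable_sets[of _ "trial_block M X k l" _ "{m}"] by fastforce
  moreover have "(\<lambda>\<omega>. \<Sum>j=k..l. of_bool (X j \<omega>) :: nat) -` {m} \<inter> space M =
      {\<omega> \<in> space M. (\<Sum>j=k..l. of_bool (X j \<omega>)) = m}" by blast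
  ultimately show ?thesis by argo
qed

section \<open>Threshold rules and their winning events\<close>

lemma threshold_rule_eq_Some_iff:
  "threshold_rule X n k \<omega> = Some j \<longleftrightarrow> j \<in> {k..n} \<and> X j \<omega> \<and> (\<forall>i\<in>{k..<j}. \<not> X i \<omega>)"
proof (cases "\<exists>j\<in>{k..n}. X j \<omega>")
  case True
  define l where "l = (LEAST j. j \<in> {k..n} \<and> X j \<omega>)"
  have "\<exists>j. j \<in> {k..n} \<and> X j \<omega>" using True by blast
  then have l: "l \<in> {k..n} \<and> X l \<omega>" unfolding l_def by (rule LeastI_ex)
  have below: "\<not> X i \<omega>" if "i \<in> {k..<l}" for i
    using not_less_Least[of i "\<lambda>j. j \<in> {k..n} \<and> X j \<omega>"] that l unfolding l_def[symmetric] by auto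
  have "threshold_rule X n k \<omega> = Some l" using True by (simp add: threshold_rule_def l_def)
  moreover have "l = j" if "j \<in> {k..n}" "X j \<omega>" "\<forall>i\<in>{k..<j}. \<not> X i \<omega>"
    using that l below by (metis atLeastAtMost_iff atLeastLessThan_iff linorder_neqE_nat)
  ultimately show ?thesis using l below by auto
next
  case False
  then show ?thesis by (auto simp: threshold_rule_def)
qed

lemma threshold_rule_mem:
  assumes "1 \<le> k"
  shows "threshold_rule X n k \<in> stopping_rules M X n"
proof -
  have adapted: "{\<omega> \<in> space M. threshold_rule X n k \<omega> = Some j} \<in> sets (trial_block M X 1 j)" if "j \<in> {1..n}" for j
  proof (cases "j \<in> {k..n}")
    case True
    have [measurable]: "X j \<in> measurable (trial_block M X 1 j) (count_space UNIV)"
      using that by (intro measurable_trial_block) auto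
    have [measurable]: "X i \<in> measurable (trial_block M X 1 j) (count_space UNIV)" if "i \<in> {k..<j}" for i
      using that assms by (intro measurable_trial_block) auto
    have "{\<omega> \<in> space (trial_block M X 1 j). X j \<omega> \<and> (\<forall>i\<in>{k..<j}. \<not> X i \<omega>)} \<in> sets (trial_block M X 1 j)"
      by measurable
    then show ?thesis by (simp only: threshold_rule_eq_Some_iff space_trial_block True simp_thms)
  next
    case False
    then have "{\<omega> \<in> space M. threshold_rule X n k \<omega> = Some j} = {}"
      by (auto simp: threshold_rule_eq_Some_iff)
    then show ?thesis by (simp only: sets.empty_sets)
  qed
  show ?thesis
    unfolding stopping_rules_def trial_filtration_eq_block mem_Collect_eq
  proof (intro conjI ballI allI impI)
    fix j assume "j \<in> {1..n}"
    then show "{\<omega> \<in> space M. threshold_rule X n k \<omega> = Some j} \<in> sets (trial_block M X 1 j)"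
      by (rule adapted)
  next
    fix \<omega> j assume "threshold_rule X n k \<omega> = Some j"
    then show "j \<in> {1..n}" "X j \<omega>" using assms by (simp_all add: threshold_rule_eq_Some_iff)
  qed
qed

text \<open>Trials from \<open>k\<close> up to the stopping index fail and leave the count
  unchanged. If the rule never stops, the count is 0, which \<open>m >= 1\<close> keeps apart from a
  win.\<close>

lemma win_prob_threshold_rule:
  assumes "m \<ge> 1"
  shows "win_prob M X n m (threshold_rule X n k) =
    measure M {\<omega> \<in> space M. (\<Sum>j=k..n. of_bool (X j \<omega>)) = m}"
proof -
  have "(\<exists>l. threshold_rule X n k \<omega> = Some l \<and> (\<Sum>j=l..n. of_bool (X j \<omega>)) = m) \<longleftrightarrow>
    (\<Sum>j=k..n. of_bool (X j \<omega>)) = m" for \<omega>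
  proof (cases "threshold_rule X n k \<omega>")
    case None
    then have "(\<Sum>j=k..n. of_bool (X j \<omega>)) = (0::nat)"
      by (auto simp: threshold_rule_def split: if_splits)
    with None assms show ?thesis by simp
  next
    case (Some l)
    then have "l \<in> {k..n}" "\<forall>i\<in>{k..<l}. \<not> X i \<omega>"
      by (simp_all add: threshold_rule_eq_Some_iff)
    then have "(\<Sum>j=k..n. of_bool (X j \<omega>)) = (\<Sum>j=l..n. of_bool (X j \<omega>) :: nat)"
      by (intro sum.mono_neutral_right) auto
    then show ?thesis using Some by simp
  qed
  then show ?thesis by (simp add: win_prob_def)
qed

section \<open>Independence of past and future, and backward induction\<close>

context bernoulli_trials
begin

lemma X_measurable: "i \<in> {1..n} \<Longrightarrow> random_variable (count_space UNIV) (X i)"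
  using indep by (auto simp: indep_vars_def)

lemma success_prob_bounds: "p ` {1..n} \<subseteq> {0..1}"
proof (rule image_subsetI)
  fix k assume "k \<in> {1..n}"
  then show "p k \<in> {0..1}" using success_prob[of k] by (auto simp flip: success_prob)
qed

lemma trial_block_subset_events:
  assumes "1 \<le> k" "l \<le> n"
  shows "sets (trial_block M X k l) \<subseteq> events"
  unfolding sets_trial_block
proof (rule sets.sigma_sets_subset, safe)
  fix i A assume "i \<in> {k..l}"
  then show "X i -` A \<inter> space M \<in> events"
    using assms by (intro measurable_sets[OF X_measurable]) auto
qed

text \<open>Grouping independent trials by disjoint index ranges yields independent sigma-algebras,
  since the generators of each trial are closed under intersection. Empty ranges are
  allowed.\<close>

lemma prob_Int_trial_blocks:
  assumes A: "A \<in> sets (trial_block M X k l)" and B: "B \<in> sets (trial_block M X k' l')"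
    and order: "1 \<le> k" "l < k'" "l \<le> n" "l' \<le> n"
  shows "prob (A \<inter> B) = prob A * prob B"
proof -
  let ?I = "case_bool {k..l} {k'..l'} :: bool \<Rightarrow> nat set"
  define E where "E i = {X i -` A \<inter> space M | A. A \<in> sets (count_space (UNIV :: bool set))}" for i
  have "indep_sets (\<lambda>b. sigma_sets (space M) (\<Union>i\<in>?I b. E i)) UNIV"
  proof (rule indep_sets_collect_sigma)
    have "indep_sets E {1..n}" using indep unfolding indep_vars_def2 E_def by auto
    moreover have "(\<Union>b. ?I b) \<subseteq> {1..n}"
      using order by (auto split: bool.splits)
    ultimately show "indep_sets E (\<Union>b. ?I b)" by (rule indep_sets_mono_index[rotated])
    show "Int_stable (E i)" for i
    proof (rule Int_stableI)
      fix A B assume "A \<in> E i" "B \<in> E i"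
      then obtain A' B' where "A = X i -` A' \<inter> space M" "B = X i -` B' \<inter> space M"
        unfolding E_def by blast
      then have "A \<inter> B = X i -` (A' \<inter> B') \<inter> space M" by blast
      then show "A \<inter> B \<in> E i" unfolding E_def by (intro CollectI exI conjI) (assumption, simp)
    qed
    show "disjoint_family ?I" using order by (auto simp: disjoint_family_on_def split: bool.splits)
  qed
  moreover have block: "sigma_sets (space M) (\<Union>i\<in>{c..d}. E i) = sets (trial_block M X c d)" for c d
    unfolding sets_trial_block E_def sets_count_space Pow_UNIV
    by (rule arg_cong2[where f = sigma_sets, OF refl]) blast
  have "(\<lambda>b. sigma_sets (space M) (\<Union>i\<in>?I b. E i)) =
      case_bool (sets (trial_block M X k l)) (sets (trial_block M X k' l'))"
    by (rule ext) (simp add: block split: bool.split)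
  ultimately have "indep_set (sets (trial_block M X k l)) (sets (trial_block M X k' l'))"
    unfolding indep_set_def by simp
  then show ?thesis using A B by (rule indep_setD)
qed

text \<open>Conditioning on trial \<open>k\<close>, which is independent of the later count,
  reproduces the recursion of \<open>pois_binomial\<close>. The induction runs backwards from the
  empty range at \<open>Suc n\<close>.\<close>

lemma prob_successes:
  assumes "1 \<le> k" "k \<le> Suc n"
  shows "prob {\<omega> \<in> space M. (\<Sum>j=k..n. of_bool (X j \<omega>)) = m} = pois_binomial (map p [k..<Suc n]) m"
  using assms(2,1)
proof (induction arbitrary: m rule: inc_induct)
  case base
  show ?case by (auto simp: prob_space)
next
  case (step k)
  let ?S = "\<lambda>m. {\<omega> \<in> space M. (\<Sum>j=Suc k..n. of_bool (X j \<omega>)) = (m::nat)}"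
  let ?X = "{\<omega> \<in> space M. X k \<omega>}" and ?Y = "{\<omega> \<in> space M. \<not> X k \<omega>}"
  have k: "k \<in> {1..n}" using step by auto
  have [measurable]: "X k \<in> measurable (trial_block M X k k) (count_space UNIV)"
    by (rule measurable_trial_block) auto
  have "{\<omega> \<in> space (trial_block M X k k). X k \<omega>} \<in> sets (trial_block M X k k)"
    "{\<omega> \<in> space (trial_block M X k k). \<not> X k \<omega>} \<in> sets (trial_block M X k k)" by measurable
  then have XY: "?X \<in> sets (trial_block M X k k)" "?Y \<in> sets (trial_block M X k k)" by simp_all
  have XY_events: "?X \<in> events" "?Y \<in> events" using XY trial_block_subset_events[of k k] k by auto
  have S: "?S m \<in> sets (trial_block M X (Suc k) n)" for m by (rule successes_trial_block)
  have S_events: "?S m \<in> events" for m using S trial_block_subset_events[of "Suc k" n] by auto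
  have "?Y = space M - ?X" by auto
  then have prob_Y: "prob ?Y = 1 - p k" using success_prob[OF k] prob_compl[OF XY_events(1)] by simp
  have "{k..n} = insert k {Suc k..n}" using k by auto
  then have sum: "(\<Sum>j=k..n. of_bool (X j \<omega>)) = of_bool (X k \<omega>) + (\<Sum>j=Suc k..n. of_bool (X j \<omega>) :: nat)" for \<omega>
    by simp
  have "{\<omega> \<in> space M. (\<Sum>j=k..n. of_bool (X j \<omega>)) = m} =
      (case m of 0 \<Rightarrow> {} | Suc i \<Rightarrow> ?X \<inter> ?S i) \<union> (?Y \<inter> ?S m)"
    unfolding sum by (cases m) auto
  then have "prob {\<omega> \<in> space M. (\<Sum>j=k..n. of_bool (X j \<omega>)) = m} =
      prob (case m of 0 \<Rightarrow> {} | Suc i \<Rightarrow> ?X \<inter> ?S i) + prob (?Y \<inter> ?S m)"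
    using XY_events S_events by (simp only:) (rule finite_measure_Union, auto split: nat.splits)
  also have "prob (?Y \<inter> ?S m) = (1 - p k) * prob (?S m)"
    using prob_Int_trial_blocks[OF XY(2) S] k by (simp add: prob_Y)
  also have "prob (case m of 0 \<Rightarrow> {} | Suc i \<Rightarrow> ?X \<inter> ?S i) = p k * shift_right (\<lambda>i. prob (?S i)) m"
    using prob_Int_trial_blocks[OF XY(1) S] k by (cases m) (simp_all add: success_prob)
  also have "(\<lambda>i. prob (?S i)) = pois_binomial (map p [Suc k..<Suc n])"
    using step.IH step.prems by auto
  also have "p k * shift_right (pois_binomial (map p [Suc k..<Suc n])) m +
      (1 - p k) * pois_binomial (map p [Suc k..<Suc n]) m = pois_binomial (map p [k..<Suc n]) m"
    using k by (simp add: upt_conv_Cons del: upt_Suc)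
  finally show ?case .
qed

text \<open>A rule stops only on a success, so a stop at \<open>k\<close> wins exactly if
  \<open>i\<close> successes follow. Stopping at \<open>k\<close> depends on the trials up to
  \<open>k\<close>, the later count on the rest, so the probabilities multiply.\<close>

lemma win_prob_eq_sum:
  assumes \<tau>: "\<tau> \<in> stopping_rules M X n"
  shows "win_prob M X n (Suc i) \<tau> =
    (\<Sum>k=1..n. prob {\<omega> \<in> space M. \<tau> \<omega> = Some k} * pois_binomial (map p [Suc k..<Suc n]) i)"
proof -
  let ?A = "\<lambda>k. {\<omega> \<in> space M. \<tau> \<omega> = Some k}"
  let ?S = "\<lambda>k. {\<omega> \<in> space M. (\<Sum>j=Suc k..n. of_bool (X j \<omega>)) = i}"
  have A: "?A k \<in> sets (trial_block M X 1 k)" if "k \<in> {1..n}" for k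
    using \<tau> that by (simp add: stopping_rules_def trial_filtration_eq_block)
  have S: "?S k \<in> sets (trial_block M X (Suc k) n)" for k by (rule successes_trial_block)
  have events: "?A k \<in> events" "?S k \<in> events" if "k \<in> {1..n}" for k
    using A[OF that] S[of k] that trial_block_subset_events[of 1 k]
      trial_block_subset_events[of "Suc k" n] by auto
  have "{\<omega> \<in> space M. \<exists>k. \<tau> \<omega> = Some k \<and> (\<Sum>j=k..n. of_bool (X j \<omega>)) = Suc i} =
      (\<Union>k\<in>{1..n}. ?A k \<inter> ?S k)"
  proof -
    have "(\<Sum>j=k..n. of_bool (X j \<omega>)) = Suc (\<Sum>j=Suc k..n. of_bool (X j \<omega>))" "k \<in> {1..n}"
      if "\<omega> \<in> space M" "\<tau> \<omega> = Some k" for \<omega> k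
    proof -
      show k: "k \<in> {1..n}" using \<tau> that by (simp add: stopping_rules_def)
      have "X k \<omega>" using \<tau> that by (simp add: stopping_rules_def)
      moreover have "{k..n} = insert k {Suc k..n}" using k by auto
      ultimately show "(\<Sum>j=k..n. of_bool (X j \<omega>)) = Suc (\<Sum>j=Suc k..n. of_bool (X j \<omega>))" by simp
    qed
    then show ?thesis by fastforce
  qed
  then have "win_prob M X n (Suc i) \<tau> = prob (\<Union>k\<in>{1..n}. ?A k \<inter> ?S k)"
    by (simp only: win_prob_def)
  also have "\<dots> = (\<Sum>k=1..n. prob (?A k \<inter> ?S k))"
    using events by (intro finite_measure_finite_Union) (auto simp: disjoint_family_on_def)
  also have "\<dots> = (\<Sum>k=1..n. prob (?A k) * pois_binomial (map p [Suc k..<Suc n]) i)"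
  proof (rule sum.cong[OF refl])
    fix k assume k: "k \<in> {1..n}"
    have "prob (?A k \<inter> ?S k) = prob (?A k) * prob (?S k)"
      using k by (intro prob_Int_trial_blocks[OF A S]) auto
    then show "prob (?A k \<inter> ?S k) = prob (?A k) * pois_binomial (map p [Suc k..<Suc n]) i"
      using k prob_successes[of "Suc k" i] by simp
  qed
  finally show ?thesis .
qed

text \<open>Here \<open>U k\<close> plays the role of a bound on the optimal value when the rule has not
  stopped before \<open>k\<close>.\<close>

lemma win_prob_le:
  assumes \<tau>: "\<tau> \<in> stopping_rules M X n"
    and U_end: "0 \<le> U (Suc n)"
    and U_mono: "\<And>k. k \<in> {1..n} \<Longrightarrow> U (Suc k) \<le> U k"
    and U_step: "\<And>k. k \<in> {1..n} \<Longrightarrow>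
      p k * pois_binomial (map p [Suc k..<Suc n]) i + (1 - p k) * U (Suc k) \<le> U k"
  shows "win_prob M X n (Suc i) \<tau> \<le> U 1"
proof -
  let ?A = "\<lambda>k. {\<omega> \<in> space M. \<tau> \<omega> = Some k}"
  \<comment> \<open>\<open>?C k\<close>, not having stopped before \<open>k\<close>, is decided by
    the first \<open>k - 1\<close> trials and hence independent of trial \<open>k\<close>.\<close>
  let ?C = "\<lambda>k. {\<omega> \<in> space M. \<forall>j\<in>{1..<k}. \<tau> \<omega> \<noteq> Some j}"
  let ?r = "\<lambda>k. pois_binomial (map p [Suc k..<Suc n]) i"
  have A: "?A k \<in> sets (trial_block M X 1 k)" if "k \<in> {1..n}" for k
    using \<tau> that by (simp add: stopping_rules_def trial_filtration_eq_block)
  have C: "?C k \<in> sets (trial_block M X 1 (k - 1))" if "k \<in> {1..Suc n}" for k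
  proof -
    have "?A j \<in> sets (trial_block M X 1 (k - 1))" if "j \<in> {1..<k}" for j
    proof -
      have "j \<in> {1..n}" "j \<le> k - 1" using that \<open>k \<in> {1..Suc n}\<close> by auto
      then show ?thesis using A sets_trial_block_mono[OF order_refl] by blast
    qed
    then have "space (trial_block M X 1 (k - 1)) - (\<Union>j\<in>{1..<k}. ?A j) \<in> sets (trial_block M X 1 (k - 1))"
      by (intro sets.compl_sets sets.finite_UN) auto
    moreover have "space (trial_block M X 1 (k - 1)) - (\<Union>j\<in>{1..<k}. ?A j) = ?C k"
      unfolding space_trial_block by blast
    ultimately show ?thesis by argo
  qed
  have A_events: "?A k \<in> events" if "k \<in> {1..n}" for k
    using A[OF that] that trial_block_subset_events[of 1 k] by auto
  have C_events: "?C k \<in> events" if "k \<in> {1..Suc n}" for k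
  proof -
    have "k - 1 \<le> n" using that by auto
    then show ?thesis using C[OF that] trial_block_subset_events[OF order_refl] by blast
  qed
  \<comment> \<open>Backward induction: the left side is the probability of winning by a stop at
    \<open>k\<close> or later.\<close>
  have tail: "(\<Sum>j=k..n. prob (?A j) * ?r j) \<le> prob (?C k) * U k" if "k \<le> Suc n" "1 \<le> k" for k
    using that
  proof (induction rule: inc_induct)
    case base
    show ?case using U_end by simp
  next
    case (step k)
    have k: "k \<in> {1..n}" using step by auto
    have X_block: "{\<omega> \<in> space M. X k \<omega>} \<in> sets (trial_block M X k k)"
    proof -
      have "X k -` {True} \<inter> space M \<in> sets (trial_block M X k k)"
        unfolding sets_trial_block by (intro sigma_sets.Basic) auto
      moreover have "X k -` {True} \<inter> space M = {\<omega> \<in> space M. X k \<omega>}" by auto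
      ultimately show ?thesis by argo
    qed
    have C_eq: "?C k = ?C (Suc k) \<union> ?A k"
    proof -
      have "{1..<Suc k} = insert k {1..<k}" using k by auto
      then show ?thesis by fastforce
    qed
    have split: "prob (?C k) = prob (?C (Suc k)) + prob (?A k)"
      unfolding C_eq using k C_events[of "Suc k"] A_events[of k]
      by (intro finite_measure_Union) auto
    have sub: "?A k \<subseteq> ?C k \<inter> {\<omega> \<in> space M. X k \<omega>}"
      using \<tau> by (auto simp: stopping_rules_def)
    have "prob (?A k) \<le> prob (?C k \<inter> {\<omega> \<in> space M. X k \<omega>})"
      using sub C_events[of k] X_block trial_block_subset_events[of k k] k
      by (intro finite_measure_mono) auto
    also have "\<dots> = prob (?C k) * p k"
      using prob_Int_trial_blocks[OF C X_block] k by (simp add: success_prob)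
    finally have A_le: "prob (?A k) \<le> prob (?C k) * p k" .
    \<comment> \<open>The factor \<open>?r k - U (Suc k)\<close> is the gain of stopping at
      \<open>k\<close> over continuing. If it is nonnegative, the bound on
      \<open>prob (?A k)\<close> and \<open>U_step\<close> apply; otherwise \<open>U_mono\<close>
      suffices.\<close>
    have "prob (?A k) * (?r k - U (Suc k)) \<le> prob (?C k) * (U k - U (Suc k))"
    proof (cases "U (Suc k) \<le> ?r k")
      case True
      then have "prob (?A k) * (?r k - U (Suc k)) \<le> prob (?C k) * p k * (?r k - U (Suc k))"
        by (intro mult_right_mono[OF A_le]) simp
      also have "\<dots> = prob (?C k) * (p k * (?r k - U (Suc k)))" by simp
      also have "\<dots> \<le> prob (?C k) * (U k - U (Suc k))"
        using U_step[OF k] by (intro mult_left_mono) (simp_all add: algebra_simps)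
      finally show ?thesis .
    next
      case False
      then have "prob (?A k) * (?r k - U (Suc k)) \<le> 0" by (simp add: mult_nonneg_nonpos)
      also have "0 \<le> prob (?C k) * (U k - U (Suc k))" using U_mono[OF k] by simp
      finally show ?thesis .
    qed
    moreover have "(\<Sum>j=Suc k..n. prob (?A j) * ?r j) \<le> prob (?C (Suc k)) * U (Suc k)"
      using step by simp
    moreover have "(\<Sum>j=k..n. prob (?A j) * ?r j) = prob (?A k) * ?r k + (\<Sum>j=Suc k..n. prob (?A j) * ?r j)"
      using k by (intro sum.atLeast_Suc_atMost) auto
    moreover have "prob (?C (Suc k)) * U (Suc k) = (prob (?C k) - prob (?A k)) * U (Suc k)"
      using split by simp
    ultimately show ?case by (simp add: algebra_simps)
  qed
  show ?thesis using tail[of 1] win_prob_eq_sum[OF \<tau>] by (simp add: prob_space)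
qed

text \<open>The value of the threshold policy at \<open>s\<close> satisfies the hypotheses of
  \<open>win_prob_le\<close>. For \<open>s = Suc n\<close> the bound is 0.\<close>

lemma win_prob_le_threshold:
  assumes "m \<ge> 1"
  obtains s where "1 \<le> s" "s \<le> Suc n"
    and "\<And>\<tau>. \<tau> \<in> stopping_rules M X n \<Longrightarrow>
      win_prob M X n m \<tau> \<le> pois_binomial (map p [s..<Suc n]) m"
proof -
  define a where "a k = pois_binomial (map p [k..<Suc n])" for k
  obtain i where m: "m = Suc i" using assms by (cases m) auto
  obtain s where s: "1 \<le> s" "s \<le> Suc n"
    and below: "\<And>k. 1 \<le> k \<Longrightarrow> k < s \<Longrightarrow> a (Suc k) i \<le> a (Suc k) m"
    and above: "\<And>k. s \<le> k \<Longrightarrow> k \<le> n \<Longrightarrow> a (Suc k) m \<le> a (Suc k) i"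
    using pois_binomial_threshold[OF success_prob_bounds, where m = "Suc i", unfolded shift_right_simps]
    unfolding a_def m by blast
  have rec: "a k m = p k * a (Suc k) i + (1 - p k) * a (Suc k) m" if "k \<in> {1..n}" for k
    using that by (simp add: a_def m upt_conv_Cons del: upt_Suc)
  have p: "0 \<le> p k" "p k \<le> 1" if "k \<in> {1..n}" for k
    using success_prob_bounds that by (auto simp: image_subset_iff)
  \<comment> \<open>With \<open>increasing\<close> below: \<open>a k m\<close> rises in
    \<open>k\<close> up to \<open>s\<close> and falls afterwards.\<close>
  have decreasing: "a (Suc k) m \<le> a k m" if k: "k \<in> {1..n}" "s \<le> k" for k
  proof -
    have "p k * a (Suc k) m \<le> p k * a (Suc k) i" using above p k by (intro mult_left_mono) auto
    then show ?thesis unfolding rec[OF k(1)] by (simp add: algebra_simps)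
  qed
  have increasing: "a j m \<le> a k m" if "j \<le> k" "1 \<le> j" "k \<le> s" for j k
    using that
  proof (induction rule: inc_induct)
    case (step j)
    have j: "j \<in> {1..n}" using step s by auto
    have "p j * a (Suc j) i \<le> p j * a (Suc j) m" using below p[OF j] step by (intro mult_left_mono) auto
    then have "a j m \<le> a (Suc j) m" unfolding rec[OF j] by (simp add: algebra_simps)
    then show ?case using step by auto
  qed simp
  have "win_prob M X n m \<tau> \<le> a s m" if "\<tau> \<in> stopping_rules M X n" for \<tau>
  proof -
    \<comment> \<open>The winning probability of the threshold policy at \<open>s\<close> when play
      resumes at trial \<open>k\<close>.\<close>
    let ?U = "\<lambda>k. a (max k s) m"
    have "win_prob M X n (Suc i) \<tau> \<le> ?U 1"
    proof (rule win_prob_le[OF that])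
      show "0 \<le> ?U (Suc n)" using s by (simp add: a_def max_absorb1)
      fix k assume k: "k \<in> {1..n}"
      have "?U (Suc k) \<le> ?U k \<and> p k * a (Suc k) i + (1 - p k) * ?U (Suc k) \<le> ?U k"
      proof (cases "s \<le> k")
        case True
        then show ?thesis using decreasing[OF k] rec[OF k] by (simp add: max_def)
      next
        case False
        then have max: "max (Suc k) s = s" "max k s = s" by auto
        \<comment> \<open>Before \<open>s\<close>, stopping is worth at most passing on to
          \<open>Suc k\<close>, and that at most the value at \<open>s\<close>.\<close>
        have "a (Suc k) i \<le> a s m"
          using below[of k] increasing[of "Suc k" s] False k by auto
        then have "p k * a (Suc k) i \<le> p k * a s m" using p[OF k] by (intro mult_left_mono)
        then show ?thesis unfolding max by (simp add: algebra_simps)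
      qed
      then show "?U (Suc k) \<le> ?U k"
        and "p k * pois_binomial (map p [Suc k..<Suc n]) i + (1 - p k) * ?U (Suc k) \<le> ?U k"
        by (simp_all only: a_def)
    qed
    then show ?thesis using s by (simp add: m max_absorb2)
  qed
  then show thesis using that s unfolding a_def by blast
qed

end

section \<open>Asymptotics\<close>

text \<open>The probability that customer \<open>k\<close> opens a new table in the Chinese
  restaurant process with parameter \<theta>; for \<theta> = 1 these are the record probabilities
  \<open>1 / k\<close>.\<close>

definition ewens_prob :: "real \<Rightarrow> nat \<Rightarrow> real" where
  "ewens_prob \<theta> k = \<theta> / (\<theta> + real k - 1)"

context
  fixes \<theta> :: real
  assumes \<theta>_pos: "\<theta> > 0"
begin

text \<open>Each term dominates \<theta> times an increment of \<open>ln\<close> over the unit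
  interval to its right; the increments telescope.\<close>

lemma sum_ewens_prob_ge:
  assumes "1 \<le> k" "k \<le> Suc n"
  shows "\<theta> * (ln (\<theta> + real n) - ln (\<theta> + real k - 1)) \<le> (\<Sum>j=k..n. ewens_prob \<theta> j)"
  using assms(2,1)
proof (induction rule: inc_induct)
  case (step k)
  let ?x = "\<theta> + real k - 1"
  have "ln (?x + 1) - ln ?x \<le> (?x + 1 - ?x) / ?x"
    using \<theta>_pos step by (intro ln_diff_le) auto
  then have "\<theta> * (ln (?x + 1) - ln ?x) \<le> \<theta> * (1 / ?x)"
    using \<theta>_pos by (intro mult_left_mono) auto
  moreover have "(\<Sum>j=k..n. ewens_prob \<theta> j) = ewens_prob \<theta> k + (\<Sum>j=Suc k..n. ewens_prob \<theta> j)"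
    using step by (intro sum.atLeast_Suc_atMost) auto
  ultimately show ?case using step by (simp add: ewens_prob_def algebra_simps)
qed simp

text \<open>The same comparison with the interval to the left. Here \<open>2 <= k\<close> keeps the
  argument \<open>\<theta> + real k - 2\<close> of \<open>ln\<close> positive.\<close>

lemma sum_ewens_prob_le:
  assumes "2 \<le> k" "k \<le> Suc n"
  shows "(\<Sum>j=k..n. ewens_prob \<theta> j) \<le> \<theta> * (ln (\<theta> + real n - 1) - ln (\<theta> + real k - 2))"
  using assms(2,1)
proof (induction rule: inc_induct)
  case (step k)
  let ?x = "\<theta> + real k - 1"
  have "ln (?x - 1) - ln ?x \<le> (?x - 1 - ?x) / ?x"
    using \<theta>_pos step by (intro ln_diff_le) auto
  then have "1 / ?x \<le> ln ?x - ln (?x - 1)" by simp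
  then have "\<theta> * (1 / ?x) \<le> \<theta> * (ln ?x - ln (?x - 1))"
    using \<theta>_pos by (intro mult_left_mono) auto
  moreover have "(\<Sum>j=k..n. ewens_prob \<theta> j) = ewens_prob \<theta> k + (\<Sum>j=Suc k..n. ewens_prob \<theta> j)"
    using step by (intro sum.atLeast_Suc_atMost) auto
  ultimately show ?case using step by (simp add: ewens_prob_def algebra_simps)
qed simp

text \<open>Telescoping with \<open>1 / x^2 <= 1 / (x - 1) - 1 / x\<close>. The Poisson error from
  trial \<open>k\<close> on is thus of order \<open>1 / k\<close>.\<close>

lemma sum_ewens_prob_squared_le:
  assumes "2 \<le> k" "k \<le> Suc n"
  shows "(\<Sum>j=k..n. (ewens_prob \<theta> j)\<^sup>2) \<le> \<theta>\<^sup>2 / (\<theta> + real k - 2)"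
proof -
  have "(\<Sum>j=k..n. (ewens_prob \<theta> j)\<^sup>2) \<le> \<theta>\<^sup>2 * (1 / (\<theta> + real k - 2) - 1 / (\<theta> + real n - 1))"
    using assms(2,1)
  proof (induction rule: inc_induct)
    case (step k)
    let ?x = "\<theta> + real k - 1"
    have x: "?x > 1" using \<theta>_pos step by auto
    then have "1 / ?x\<^sup>2 \<le> 1 / ((?x - 1) * ?x)"
      by (intro divide_left_mono) (auto simp: power2_eq_square)
    also have "\<dots> = 1 / (?x - 1) - 1 / ?x" using x by (simp add: field_simps)
    finally have "\<theta>\<^sup>2 * (1 / ?x\<^sup>2) \<le> \<theta>\<^sup>2 * (1 / (?x - 1) - 1 / ?x)" by (intro mult_left_mono) auto
    moreover have "(\<Sum>j=k..n. (ewens_prob \<theta> j)\<^sup>2) = (ewens_prob \<theta> k)\<^sup>2 + (\<Sum>j=Suc k..n. (ewens_prob \<theta> j)\<^sup>2)"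
      using step by (intro sum.atLeast_Suc_atMost) auto
    moreover have "(ewens_prob \<theta> k)\<^sup>2 = \<theta>\<^sup>2 * (1 / ?x\<^sup>2)" by (simp add: ewens_prob_def power_divide)
    moreover have "(\<Sum>j=Suc k..n. (ewens_prob \<theta> j)\<^sup>2) \<le> \<theta>\<^sup>2 * (1 / ?x - 1 / (\<theta> + real n - 1))"
      using step by (simp add: algebra_simps)
    moreover have "?x - 1 = \<theta> + real k - 2" by simp
    ultimately show ?case by (simp add: right_diff_distrib)
  qed simp
  also have "\<dots> \<le> \<theta>\<^sup>2 * (1 / (\<theta> + real k - 2))"
    using \<theta>_pos assms by (intro mult_left_mono) auto
  finally show ?thesis by simp
qed

section \<open>Poisson approximation for the Ewens trials\<close>

lemma ewens_prob_bounds: "1 \<le> k \<Longrightarrow> 0 \<le> ewens_prob \<theta> k" "1 \<le> k \<Longrightarrow> ewens_prob \<theta> k \<le> 1"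
  using \<theta>_pos by (auto simp: ewens_prob_def)

lemma set_ewens_probs: "1 \<le> k \<Longrightarrow> set (map (ewens_prob \<theta>) [k..<l]) \<subseteq> {0..1}"
  using ewens_prob_bounds by auto

lemma pois_binomial_ewens_poisson_mass:
  assumes "2 \<le> k" "k \<le> Suc n"
  shows "\<bar>pois_binomial (map (ewens_prob \<theta>) [k..<Suc n]) m - poisson_mass (\<Sum>j=k..n. ewens_prob \<theta> j) m\<bar>
    \<le> 2 * (\<theta>\<^sup>2 / (\<theta> + real k - 2))"
proof -
  have interval: "{k..<Suc n} = {k..n}" by auto
  have "sum_list (map f [k..<Suc n]) = (\<Sum>j=k..n. f j)" for f :: "nat \<Rightarrow> real"
    by (simp only: sum_set_upt_conv_sum_list_nat[symmetric] set_upt interval)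
  then show ?thesis
    using pois_binomial_poisson_mass[OF set_ewens_probs, of k "Suc n" m]
      sum_ewens_prob_squared_le[OF assms] assms
    by (simp add: map_map comp_def del: upt_Suc)
qed

text \<open>The last two bounds make \<open>k_poi m \<theta> n\<close> the ceiling of
  \<open>c * n\<close>. The set contains \<open>n\<close> because \<open>c <= 1\<close>, and the
  predecessor of its minimum, if positive, lies outside it.\<close>

lemma k_poi_bounds:
  fixes m n :: nat
  assumes "n \<ge> 1"
  defines "c \<equiv> exp (- (real m / \<theta>))"
  shows "1 \<le> k_poi m \<theta> n" "k_poi m \<theta> n \<le> n" "c * real n \<le> real (k_poi m \<theta> n)"
    "real (k_poi m \<theta> n) < c * real n + 1"
proof -
  let ?S = "{k \<in> {1..n}. real k / real n \<ge> c}"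
  have "c \<le> 1" using \<theta>_pos by (simp add: c_def)
  then have "n \<in> ?S" using assms(1) by auto
  then have Min: "Min ?S \<in> ?S" by (intro Min_in) auto
  then have k: "k_poi m \<theta> n = Min ?S" by (simp add: k_poi_def c_def max_def)
  show "1 \<le> k_poi m \<theta> n" "k_poi m \<theta> n \<le> n" "c * real n \<le> real (k_poi m \<theta> n)"
    using Min assms(1) unfolding k by (auto simp: field_simps)
  show "real (k_poi m \<theta> n) < c * real n + 1"
  proof (cases "Min ?S = 1")
    case True
    then show ?thesis using assms(1) unfolding k by (simp add: c_def)
  next
    case False
    have "Min ?S - 1 \<notin> ?S"
    proof
      assume "Min ?S - 1 \<in> ?S"
      then have "Min ?S \<le> Min ?S - 1" by (intro Min_le) auto
      then show False using Min by auto
    qed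
    then have "real (Min ?S - 1) / real n < c" using Min False by auto
    then have "real (Min ?S - 1) < c * real n" using assms(1) by (simp add: field_simps)
    then show ?thesis using Min unfolding k by (simp add: of_nat_diff)
  qed
qed

text \<open>Since the index is \<open>c * n\<close> up to 1, the mean tends to
  \<open>- \<theta> * ln c = m\<close>, and the Poisson error is of order
  \<open>1 / n\<close>.\<close>

lemma k_poi_win_prob_tendsto:
  "(\<lambda>n. pois_binomial (map (ewens_prob \<theta>) [k_poi m \<theta> n..<Suc n]) m) \<longlonglongrightarrow> poisson_mass (real m) m"
proof -
  define c where "c = exp (- (real m / \<theta>))"
  have c: "c > 0" and ln_c: "\<theta> * - ln c = real m" using \<theta>_pos by (simp_all add: c_def)
  define k where "k = k_poi m \<theta>"
  define t where "t n = (\<Sum>j=k n..n. ewens_prob \<theta> j)" for n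
  have "filterlim (\<lambda>n. c * real n) at_top sequentially" using c by real_asymp
  \<comment> \<open>This forces \<open>2 <= k n\<close>, as the upper bounds require, and keeps the
    explicit denominators below positive.\<close>
  then have "\<forall>\<^sub>F n in sequentially. c * real n \<ge> 2" by (simp add: filterlim_at_top)
  with eventually_ge_at_top[of 1]
  have ev: "\<forall>\<^sub>F n in sequentially. n \<ge> 1 \<and> c * real n \<ge> 2 \<and> 2 \<le> k n \<and> k n \<le> n \<and>
      c * real n \<le> real (k n) \<and> real (k n) < c * real n + 1"
  proof eventually_elim
    case (elim n)
    then show ?case using k_poi_bounds[of n m] unfolding k_def c_def by linarith
  qed
  have "t \<longlonglongrightarrow> real m"
  proof (rule tendsto_sandwich)
    show "\<forall>\<^sub>F n in sequentially. \<theta> * (ln (\<theta> + real n) - ln (\<theta> + c * real n)) \<le> t n"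
      using ev
    proof eventually_elim
      case (elim n)
      have "\<theta> * (ln (\<theta> + real n) - ln (\<theta> + c * real n)) \<le> \<theta> * (ln (\<theta> + real n) - ln (\<theta> + real (k n) - 1))"
        using elim \<theta>_pos c by (intro mult_left_mono diff_left_mono ln_mono) auto
      also have "\<dots> \<le> t n" unfolding t_def using elim by (intro sum_ewens_prob_ge) auto
      finally show ?case .
    qed
    show "\<forall>\<^sub>F n in sequentially. t n \<le> \<theta> * (ln (\<theta> + real n - 1) - ln (\<theta> + c * real n - 2))"
      using ev
    proof eventually_elim
      case (elim n)
      have "t n \<le> \<theta> * (ln (\<theta> + real n - 1) - ln (\<theta> + real (k n) - 2))"
        unfolding t_def using elim by (intro sum_ewens_prob_le) auto
      also have "\<dots> \<le> \<theta> * (ln (\<theta> + real n - 1) - ln (\<theta> + c * real n - 2))"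
        using elim \<theta>_pos c by (intro mult_left_mono diff_left_mono ln_mono) auto
      finally show ?case .
    qed
    have "(\<lambda>n. \<theta> * (ln (\<theta> + real n) - ln (\<theta> + c * real n))) \<longlonglongrightarrow> \<theta> * - ln c"
      using c by real_asymp
    then show "(\<lambda>n. \<theta> * (ln (\<theta> + real n) - ln (\<theta> + c * real n))) \<longlonglongrightarrow> real m" unfolding ln_c .
    have "(\<lambda>n. \<theta> * (ln (\<theta> + real n - 1) - ln (\<theta> + c * real n - 2))) \<longlonglongrightarrow> \<theta> * - ln c"
      using c by real_asymp
    then show "(\<lambda>n. \<theta> * (ln (\<theta> + real n - 1) - ln (\<theta> + c * real n - 2))) \<longlonglongrightarrow> real m" unfolding ln_c .
  qed
  then have mass: "(\<lambda>n. poisson_mass (t n) m) \<longlonglongrightarrow> poisson_mass (real m) m"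
    unfolding poisson_mass_def by (intro tendsto_intros) auto
  have "(\<lambda>n. pois_binomial (map (ewens_prob \<theta>) [k n..<Suc n]) m - poisson_mass (t n) m) \<longlonglongrightarrow> 0"
  proof (rule Lim_null_comparison)
    show "\<forall>\<^sub>F n in sequentially. norm (pois_binomial (map (ewens_prob \<theta>) [k n..<Suc n]) m - poisson_mass (t n) m)
        \<le> 2 * (\<theta>\<^sup>2 / (\<theta> + c * real n - 2))"
      using ev
    proof eventually_elim
      case (elim n)
      have "norm (pois_binomial (map (ewens_prob \<theta>) [k n..<Suc n]) m - poisson_mass (t n) m)
          \<le> 2 * (\<theta>\<^sup>2 / (\<theta> + real (k n) - 2))"
        using pois_binomial_ewens_poisson_mass[of "k n" n m] elim
        unfolding t_def real_norm_def by linarith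
      also have "\<dots> \<le> 2 * (\<theta>\<^sup>2 / (\<theta> + c * real n - 2))"
        using elim \<theta>_pos by (intro mult_left_mono divide_left_mono mult_pos_pos) auto
      finally show ?case .
    qed
    show "(\<lambda>n. 2 * (\<theta>\<^sup>2 / (\<theta> + c * real n - 2))) \<longlonglongrightarrow> 0" using c by real_asymp
  qed
  from tendsto_add[OF this mass] show ?thesis by (simp add: k_def del: upt_Suc)
qed

text \<open>The Poisson approximation is not uniform in \<open>s\<close>. For \<open>s\<close> below a slowly growing \<open>k\<close> the
  number of successes from \<open>s\<close> on is at least the number from \<open>k\<close> on, which already tends to infinity.\<close>

lemma pois_binomial_ewens_upper:
  assumes "m \<ge> 1" and s: "1 \<le> s" "s \<le> Suc n" and k: "2 \<le> k" "k \<le> Suc n"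
  shows "pois_binomial (map (ewens_prob \<theta>) [s..<Suc n]) m \<le> poisson_mass (real m) m +
    ((\<Sum>i\<le>m. poisson_mass (\<Sum>j=k..n. ewens_prob \<theta> j) i) +
     real (Suc m) * (2 * (\<theta>\<^sup>2 / (\<theta> + real k - 2))))"
proof -
  let ?t = "\<lambda>k. \<Sum>j=k..n. ewens_prob \<theta> j" and ?a = "\<lambda>k. pois_binomial (map (ewens_prob \<theta>) [k..<Suc n])"
  let ?e = "2 * (\<theta>\<^sup>2 / (\<theta> + real k - 2))"
  have t_nonneg: "0 \<le> ?t j" if "1 \<le> j" for j
    using that ewens_prob_bounds by (intro sum_nonneg) auto
  have mass_nonneg: "0 \<le> poisson_mass (?t k) i" for i
    using k by (intro poisson_mass_nonneg t_nonneg) auto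
  have e_nonneg: "0 \<le> ?e" using k \<theta>_pos by auto
  show ?thesis
  proof (cases "k \<le> s")
    \<comment> \<open>Late \<open>s\<close>: the Poisson error is at most the one at
      \<open>k\<close>, and the Poisson mass is at most its value at mean \<open>m\<close>.\<close>
    case True
    have "?a s m \<le> poisson_mass (?t s) m + 2 * (\<theta>\<^sup>2 / (\<theta> + real s - 2))"
      using pois_binomial_ewens_poisson_mass[of s n m] True s k by linarith
    also have "\<dots> \<le> poisson_mass (real m) m + ?e"
      using True s k \<theta>_pos assms(1)
      by (intro add_mono poisson_mass_le_mode t_nonneg mult_left_mono divide_left_mono mult_pos_pos) auto
    also have "?e \<le> real (Suc m) * ?e" using mult_right_mono[of 1 "real (Suc m)", OF _ e_nonneg] by simp
    also have "\<dots> \<le> (\<Sum>i\<le>m. poisson_mass (?t k) i) + \<dots>" using mass_nonneg by (simp add: sum_nonneg)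
    finally show ?thesis by simp
  next
    \<comment> \<open>Early \<open>s\<close>: the mass at \<open>m\<close> is at most the
      distribution function there, which grows when the trials before \<open>k\<close> are
      dropped.\<close>
    case False
    have split: "map (ewens_prob \<theta>) [s..<Suc n] = map (ewens_prob \<theta>) [s..<k] @ map (ewens_prob \<theta>) [k..<Suc n]"
      using False k upt_add_eq_append[of s k "Suc n - k"] by (simp flip: map_append del: upt_Suc)
    have unit: "set (map (ewens_prob \<theta>) [s..<Suc n]) \<subseteq> {0..1}" using s by (intro set_ewens_probs)
    have "?a s m \<le> (\<Sum>i\<le>m. ?a s i)"
      using pois_binomial_nonneg[OF unit] by (intro member_le_sum) auto
    also have "\<dots> \<le> (\<Sum>i\<le>m. ?a k i)"
      using unit unfolding split by (rule pois_binomial_cdf_append_le)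
    also have "\<dots> \<le> (\<Sum>i\<le>m. poisson_mass (?t k) i + ?e)"
    proof (rule sum_mono)
      show "?a k i \<le> poisson_mass (?t k) i + ?e" for i
        using pois_binomial_ewens_poisson_mass[OF k, of i] by linarith
    qed
    also have "\<dots> = (\<Sum>i\<le>m. poisson_mass (?t k) i) + real (Suc m) * ?e"
      by (simp add: sum.distrib)
    finally show ?thesis using poisson_mass_nonneg[of "real m" m] by simp
  qed
qed

text \<open>The optimal threshold is not explicit, so the error \<open>g\<close> must not depend on
  \<open>s\<close>. A cut near \<open>sqrt n\<close> works: it tends to infinity, which removes the
  Poisson error, and \<open>ln (n / sqrt n)\<close> does too, so the mean beyond the cut diverges
  and the masses up to \<open>m\<close> vanish.\<close>

lemma pois_binomial_ewens_uniform_upper: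
  assumes "m \<ge> 1"
  obtains g :: "nat \<Rightarrow> real" where "g \<longlonglongrightarrow> 0"
    and "\<forall>\<^sub>F n in sequentially. \<forall>s. 1 \<le> s \<and> s \<le> Suc n \<longrightarrow>
      pois_binomial (map (ewens_prob \<theta>) [s..<Suc n]) m \<le> poisson_mass (real m) m + g n"
proof -
  \<comment> \<open>The summand 2 ensures \<open>2 <= k n\<close> and makes the error denominator at
    least \<open>\<theta> + sqrt n\<close>.\<close>
  define k where "k n = nat \<lceil>sqrt (real n)\<rceil> + 2" for n
  define t where "t n = (\<Sum>j=k n..n. ewens_prob \<theta> j)" for n
  define g where "g n = (\<Sum>i\<le>m. poisson_mass (t n) i) +
     real (Suc m) * (2 * (\<theta>\<^sup>2 / (\<theta> + real (k n) - 2)))" for n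
  have k_lower: "sqrt (real n) + 2 \<le> real (k n)" and k_upper: "real (k n) \<le> sqrt (real n) + 3" for n
    unfolding k_def by (simp_all, linarith+)
  have "\<forall>\<^sub>F n in sequentially. sqrt (real n) + 3 \<le> real n" by real_asymp
  then have k_le: "\<forall>\<^sub>F n in sequentially. k n \<le> Suc n"
  proof eventually_elim
    case (elim n)
    then show ?case using k_upper[of n] by linarith
  qed
  have "filterlim t at_top sequentially"
  proof (rule filterlim_at_top_mono)
    show "filterlim (\<lambda>n. \<theta> * (ln (\<theta> + real n) - ln (\<theta> + sqrt (real n) + 2))) at_top sequentially"
      using \<theta>_pos by real_asymp
    show "\<forall>\<^sub>F n in sequentially. \<theta> * (ln (\<theta> + real n) - ln (\<theta> + sqrt (real n) + 2)) \<le> t n"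
      using k_le
    proof eventually_elim
      case (elim n)
      have "\<theta> * (ln (\<theta> + real n) - ln (\<theta> + sqrt (real n) + 2)) \<le>
          \<theta> * (ln (\<theta> + real n) - ln (\<theta> + real (k n) - 1))"
      proof (intro mult_left_mono diff_left_mono ln_mono)
        have "0 \<le> sqrt (real n)" by simp
        then show "0 < \<theta> + real (k n) - 1" using \<theta>_pos k_lower[of n] by linarith
      qed (use \<theta>_pos k_upper[of n] in auto)
      also have "\<dots> \<le> t n" unfolding t_def using elim by (intro sum_ewens_prob_ge) (auto simp: k_def)
      finally show ?case .
    qed
  qed
  moreover have "((\<lambda>x. poisson_mass x i) \<longlongrightarrow> 0) at_top" for i
    using tendsto_divide[OF tendsto_power_div_exp_0[of i] tendsto_const[of "fact i"]]
    by (simp add: poisson_mass_def exp_minus field_simps)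
  ultimately have "(\<lambda>n. poisson_mass (t n) i) \<longlonglongrightarrow> 0" for i
    by (rule filterlim_compose[rotated])
  then have mass: "(\<lambda>n. \<Sum>i\<le>m. poisson_mass (t n) i) \<longlonglongrightarrow> 0"
    by (intro tendsto_null_sum)
  have "(\<lambda>n. \<theta>\<^sup>2 / (\<theta> + real (k n) - 2)) \<longlonglongrightarrow> 0"
  proof (rule Lim_null_comparison)
    show "\<forall>\<^sub>F n in sequentially. norm (\<theta>\<^sup>2 / (\<theta> + real (k n) - 2)) \<le> \<theta>\<^sup>2 / (\<theta> + sqrt (real n))"
    proof (rule always_eventually, rule allI)
      fix n
      have pos: "0 < \<theta> + sqrt (real n)" using \<theta>_pos by (simp add: add_pos_nonneg)
      then have "\<theta>\<^sup>2 / (\<theta> + real (k n) - 2) \<le> \<theta>\<^sup>2 / (\<theta> + sqrt (real n))"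
        using k_lower[of n] by (intro divide_left_mono mult_pos_pos) auto
      moreover have "0 < \<theta> + real (k n) - 2" using pos k_lower[of n] by linarith
      ultimately show "norm (\<theta>\<^sup>2 / (\<theta> + real (k n) - 2)) \<le> \<theta>\<^sup>2 / (\<theta> + sqrt (real n))" by simp
    qed
    show "(\<lambda>n. \<theta>\<^sup>2 / (\<theta> + sqrt (real n))) \<longlonglongrightarrow> 0" by real_asymp
  qed
  from tendsto_add[OF mass tendsto_mult_right_zero[OF tendsto_mult_right_zero[OF this]]]
  have "g \<longlonglongrightarrow> 0" unfolding g_def by simp
  moreover have "\<forall>\<^sub>F n in sequentially. \<forall>s. 1 \<le> s \<and> s \<le> Suc n \<longrightarrow>
      pois_binomial (map (ewens_prob \<theta>) [s..<Suc n]) m \<le> poisson_mass (real m) m + g n"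
    using k_le
  proof eventually_elim
    case (elim n)
    have "2 \<le> k n" by (simp add: k_def)
    then show ?case
      using pois_binomial_ewens_upper[OF assms _ _ _ elim] unfolding g_def t_def by blast
  qed
  ultimately show thesis by (rule that)
qed

end

theorem theorem8:
  fixes \<theta> :: real and m :: nat
    and M :: "nat \<Rightarrow> 'a measure" and X :: "nat \<Rightarrow> nat \<Rightarrow> 'a \<Rightarrow> bool"
  assumes "\<theta> > 0" and "m \<ge> 1"
    and "\<And>n. n \<ge> 1 \<Longrightarrow> bernoulli_trials (M n) (X n) n (\<lambda>k. \<theta> / (\<theta> + real k - 1))"
  shows "asymptotically_optimal M X m (\<lambda>n. threshold_rule (X n) n (k_poi m \<theta> n)) \<and>
    (\<lambda>n. win_prob (M n) (X n) n m (threshold_rule (X n) n (k_poi m \<theta> n)))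
      \<longlonglongrightarrow> real m ^ m / fact m * exp (- real m) \<and>
    (\<lambda>n. optimal_win_prob (M n) (X n) n m) \<longlonglongrightarrow> real m ^ m / fact m * exp (- real m)"
proof -
  define L where "L = real m ^ m / fact m * exp (- real m)"
  define w where "w n = win_prob (M n) (X n) n m (threshold_rule (X n) n (k_poi m \<theta> n))" for n
  define opt where "opt n = optimal_win_prob (M n) (X n) n m" for n
  have L: "poisson_mass (real m) m = L" by (simp add: poisson_mass_def L_def)
  have trials: "bernoulli_trials (M n) (X n) n (ewens_prob \<theta>)" if "n \<ge> 1" for n
    using assms(3)[OF that] unfolding ewens_prob_def[abs_def] .
  have mem: "threshold_rule (X n) n (k_poi m \<theta> n) \<in> stopping_rules (M n) (X n) n" if "n \<ge> 1" for n
    using k_poi_bounds[OF assms(1) that] by (intro threshold_rule_mem)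
  have w_eq: "w n = pois_binomial (map (ewens_prob \<theta>) [k_poi m \<theta> n..<Suc n]) m" if "n \<ge> 1" for n
    unfolding w_def win_prob_threshold_rule[OF assms(2)]
    using k_poi_bounds[OF assms(1) that, of m]
    by (intro bernoulli_trials.prob_successes[OF trials[OF that]]) auto
  have "w \<longlonglongrightarrow> L"
  proof (rule Lim_transform_eventually)
    show "(\<lambda>n. pois_binomial (map (ewens_prob \<theta>) [k_poi m \<theta> n..<Suc n]) m) \<longlonglongrightarrow> L"
      using k_poi_win_prob_tendsto[OF assms(1), of m] unfolding L .
    show "\<forall>\<^sub>F n in sequentially. pois_binomial (map (ewens_prob \<theta>) [k_poi m \<theta> n..<Suc n]) m = w n"
      using eventually_ge_at_top[of 1] by eventually_elim (simp only: w_eq)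
  qed
  obtain g where g: "g \<longlonglongrightarrow> 0"
    and upper: "\<forall>\<^sub>F n in sequentially. \<forall>s. 1 \<le> s \<and> s \<le> Suc n \<longrightarrow>
      pois_binomial (map (ewens_prob \<theta>) [s..<Suc n]) m \<le> L + g n"
    using pois_binomial_ewens_uniform_upper[OF assms(1,2)] unfolding L by blast
  \<comment> \<open>The threshold rule is admissible, and the supremum is over a set bounded by
    1.\<close>
  have w_le_opt: "w n \<le> opt n" if "n \<ge> 1" for n
  proof -
    interpret bernoulli_trials "M n" "X n" n "ewens_prob \<theta>" by (rule trials[OF that])
    show ?thesis
      unfolding w_def opt_def optimal_win_prob_def
      by (rule cSUP_upper[OF mem[OF that]]) (auto intro!: bdd_aboveI2[of _ _ 1] simp: win_prob_def)
  qed
  \<comment> \<open>The \<open>s\<close> obtained here varies with \<open>n\<close> in an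
    uncontrolled way, which is why \<open>upper\<close> quantifies over all
    \<open>s\<close>.\<close>
  have opt_le: "\<forall>\<^sub>F n in sequentially. opt n \<le> L + g n"
    using upper eventually_ge_at_top[of 1]
  proof eventually_elim
    case (elim n)
    obtain s where s: "1 \<le> s" "s \<le> Suc n" "\<And>\<tau>. \<tau> \<in> stopping_rules (M n) (X n) n \<Longrightarrow>
        win_prob (M n) (X n) n m \<tau> \<le> pois_binomial (map (ewens_prob \<theta>) [s..<Suc n]) m"
      using bernoulli_trials.win_prob_le_threshold[OF trials[OF elim(2)] assms(2)] by blast
    have "opt n \<le> pois_binomial (map (ewens_prob \<theta>) [s..<Suc n]) m"
      unfolding opt_def optimal_win_prob_def using mem[OF elim(2)] s(3) by (intro cSUP_least) auto
    also have "\<dots> \<le> L + g n" using elim(1) s(1,2) by blast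
    finally show ?case .
  qed
  \<comment> \<open>The bounds \<open>w n\<close> and \<open>L + g n\<close> share the limit
    \<open>L\<close>, so the gap \<open>opt n - w n\<close> vanishes as well.\<close>
  have "opt \<longlonglongrightarrow> L"
  proof (rule tendsto_sandwich)
    show "\<forall>\<^sub>F n in sequentially. w n \<le> opt n"
      using eventually_ge_at_top[of 1] by eventually_elim (rule w_le_opt)
    show "(\<lambda>n. L + g n) \<longlonglongrightarrow> L" using tendsto_add[OF tendsto_const g, of L] by simp
  qed fact+
  moreover have "(\<lambda>n. opt n - w n) \<longlonglongrightarrow> 0"
    using tendsto_diff[OF \<open>opt \<longlonglongrightarrow> L\<close> \<open>w \<longlonglongrightarrow> L\<close>] by simp
  ultimately show ?thesis
    using mem \<open>w \<longlonglongrightarrow> L\<close> unfolding asymptotically_optimal_def w_def opt_def L_def by blast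
qed

end
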